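(* For $t=2$ pirates, under the averaging attack and minimum distance (MD) decoding, the fingerprinting capacity of the binary linear codebook ensemble $\mathcal{E}$ is $R_{\mathcal{E}}=\tfrac12$. That is: (1) for every rate $0<R<\tfrac12$, the ensemble-average misidentification probability $P_m$ at rate $R$ goes to zero exponentially fast as $n\to\infty$; (2) for every rate $\tfrac12<R<1$, there is a constant $\delta>0$ such that the ensemble-average misidentification probability at rate $R$ satisfies $P_m>\delta$ for all sufficiently large $n$.
   Context: Binary linear ensemble of length $n$ and rate $R$: let $l=\lceil n(1-R)\rceil$ and let $H$ be an $l\times n$ binary matrix whose entries are i.i.d. Bernoulli$(1/2)$. The code is $C=\{\mathbf{x}\in\mathbb{F}_2^n: H\mathbf{x}^{\mathrm T}=0\}$, of (design) dimension $n-l$ and (design) rate $1-l/n$. Users correspond to the codewords of $C$ (so $M=|C|$, which is $2^{n-l}$ when $H$ has full row rank). Each codeword is mapped coordinatewise from $\{0,1\}$ to $\{-1,+1\}$ to form the user's fingerprint. Averaging attack with $t=2$: a coalition $U$ of two distinct users with $\pm1$ fingerprints $\mathbf{x}_1,\mathbf{x}_2$ produces the forged copy $\mathbf{y}=\tfrac12(\mathbf{x}_1+\mathbf{x}_2)\in\{-1,0,1\}^n$ (real addition). MD decoder: the decoder knows the code and $\mathbf{y}$. Positions $i$ with $y_i=0$ are regarded as erased. The decoder finds the users whose fingerprint agrees with $\mathbf{y}$ in every unerased position (equivalently, solves the parity-check equations for the erased coordinates) and outputs such a user $g(\mathbf{y})$, chosen uniformly at random if there are several. Misidentification is the event $g(\mathbf{y})\notin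 U$. $P_m$ denotes the probability of misidentification averaged over the random code, over all two-element coalitions $U$ (uniformly), and over the decoder's tie-breaking. Capacity of an ensemble $\mathcal{E}$ under MD decoding: the number $R_{\mathcal{E}}$ such that for rates $R<R_{\mathcal{E}}$, $P_m\to0$ exponentially in $n$, and for rates $R>R_{\mathcal{E}}$ there is $\delta>0$ with $P_m>\delta$ for all sufficiently large $n$. *)

theory Defs
  imports
    "HOL-Probability.Probability"
    "HOL-Library.Z2"
    "Jordan_Normal_Form.Matrix_Kernel"
begin

text \<open>Binary vectors and matrices have entries in the field \<open>bit\<close> with two elements.\<close>

definition num_checks :: "nat \<Rightarrow> real \<Rightarrow> nat" where
  "num_checks n R = nat \<lceil>real n * (1 - R)\<rceil>"

text \<open>Parity-check matrix of size \<open>l \<times> n\<close> with i.i.d. Bernoulli(1/2) entries.\<close>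

definition random_parity_check :: "nat \<Rightarrow> nat \<Rightarrow> bit mat pmf" where
  "random_parity_check l n =
     map_pmf (mat l n)
       (Pi_pmf ({..<l} \<times> {..<n}) 0 (\<lambda>_. map_pmf of_bool (bernoulli_pmf (1/2))))"

definition fingerprint :: "bit vec \<Rightarrow> real vec" where
  "fingerprint x = map_vec (\<lambda>b. if b = 0 then -1 else 1) x"

text \<open>A coalition is a set of two distinct users, a user being a codeword.\<close>

definition coalitions :: "bit vec set \<Rightarrow> bit vec set set" where
  "coalitions C = {U. U \<subseteq> C \<and> card U = 2}"

definition averaging_forgery :: "nat \<Rightarrow> bit vec set \<Rightarrow> real vec" where
  "averaging_forgery n U = vec n (\<lambda>i. (\<Sum>x\<in>U. fingerprint x $ i) / real (card U))"

text \<open>Positions with \<open>y $ i = 0\<close> are erasures and impose no constraint.\<close>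

definition consistent_users :: "bit vec set \<Rightarrow> real vec \<Rightarrow> bit vec set" where
  "consistent_users C y =
     {x \<in> C. \<forall>i < dim_vec y. y $ i \<noteq> 0 \<longrightarrow> fingerprint x $ i = y $ i}"

definition md_decoder :: "bit vec set \<Rightarrow> real vec \<Rightarrow> bit vec pmf" where
  "md_decoder C y = pmf_of_set (consistent_users C y)"

text \<open>
  Distribution of the event that the decoder's output lies outside a uniformly chosen coalition.
  If the code has a single codeword there is no coalition, and the event is taken to be false;
  for the ensemble below, with rate \<open>R > 0\<close>, this can only happen when \<open>n * R < 1\<close>.
\<close>

definition misidentification :: "nat \<Rightarrow> bit vec set \<Rightarrow> bool pmf" where
  "misidentification n C =
     (if coalitions C = {} then return_pmf False
      else do {
        U \<leftarrow> pmf_of_set (coalitions C);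
        g \<leftarrow> md_decoder C (averaging_forgery n U);
        return_pmf (g \<notin> U)
      })"

text \<open>
  Ensemble-average misidentification probability at rate \<open>R\<close> and length \<open>n\<close>;
  the code is the kernel of the random parity-check matrix.
\<close>

definition misid_prob :: "real \<Rightarrow> nat \<Rightarrow> real" where
  "misid_prob R n =
     pmf (do {
       H \<leftarrow> random_parity_check (num_checks n R) n;
       misidentification n (mat_kernel H)
     }) True"

definition exponentially_vanishing :: "(nat \<Rightarrow> real) \<Rightarrow> bool" where
  "exponentially_vanishing p \<longleftrightarrow>
     (\<exists>c>0. \<forall>\<^sub>F n in sequentially. p n \<le> exp (- c * real n))"

text \<open>
  \<open>P R n\<close> is the error probability at rate \<open>R\<close> and length \<open>n\<close>, with rates in the open
  unit interval. Nothing is required at \<open>R = Rc\<close>.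
\<close>

definition is_capacity :: "(real \<Rightarrow> nat \<Rightarrow> real) \<Rightarrow> real \<Rightarrow> bool" where
  "is_capacity P Rc \<longleftrightarrow>
     0 \<le> Rc \<and> Rc \<le> 1 \<and>
     (\<forall>R. 0 < R \<and> R < Rc \<longrightarrow> exponentially_vanishing (P R)) \<and>
     (\<forall>R. Rc < R \<and> R < 1 \<longrightarrow> (\<exists>\<delta>>0. \<forall>\<^sub>F n in sequentially. P R n > \<delta>))"

lemma exponentially_vanishing_not_bounded_below:
  assumes "exponentially_vanishing p" "\<delta> > 0" "\<forall>\<^sub>F n in sequentially. p n > \<delta>"
  shows False
proof -
  obtain c where c: "c > 0" "\<forall>\<^sub>F n in sequentially. p n \<le> exp (- c * real n)"
    using assms(1) unfolding exponentially_vanishing_def by blast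
  have "(\<lambda>n. exp (- c) ^ n) \<longlonglongrightarrow> 0"
    using c(1) by (intro LIMSEQ_realpow_zero) auto
  then have "(\<lambda>n. exp (- c * real n)) \<longlonglongrightarrow> 0"
    by (simp add: exp_of_nat_mult [symmetric] mult.commute)
  then have "\<forall>\<^sub>F n in sequentially. exp (- c * real n) < \<delta>"
    using assms(2) by (rule order_tendstoD)
  with c(2) assms(3) have "\<forall>\<^sub>F n :: nat in sequentially. False"
    by eventually_elim linarith
  then show False by simp
qed

lemma is_capacity_not_less:
  assumes "is_capacity P a" "is_capacity P b"
  shows "\<not> a < b"
proof
  assume "a < b"
  then obtain R where "a < R" "R < b" using dense by blast
  moreover have "0 \<le> a" "b \<le> 1" using assms by (auto simp: is_capacity_def)
  ultimately have "0 < R" "R < 1" by linarith+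
  have "exponentially_vanishing (P R)"
    using assms(2) \<open>0 < R\<close> \<open>R < b\<close> by (auto simp: is_capacity_def)
  moreover obtain \<delta> where "\<delta> > 0" "\<forall>\<^sub>F n in sequentially. P R n > \<delta>"
    using assms(1) \<open>a < R\<close> \<open>R < 1\<close> unfolding is_capacity_def by blast
  ultimately show False
    using exponentially_vanishing_not_bounded_below by blast
qed

lemma is_capacity_unique: "is_capacity P a \<Longrightarrow> is_capacity P b \<Longrightarrow> a = b"
  using is_capacity_not_less by (meson linorder_neqE_linordered_idom)

lemma averaging_forgery_pair:
  assumes "x1 \<in> carrier_vec n" "x2 \<in> carrier_vec n" "x1 \<noteq> x2"
  shows "averaging_forgery n {x1, x2} = (1/2) \<cdot>\<^sub>v (fingerprint x1 + fingerprint x2)"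
  using assms by (intro eq_vecI) (auto simp: averaging_forgery_def fingerprint_def)

end

theory Submission
  imports Defs
begin

text \<open>
  For a linear code \<open>C\<close> and a pair \<open>{x, x + d}\<close>, the users consistent with the forgery are the
  \<open>x + e\<close> with \<open>e\<close> a codeword supported in the support of \<open>d\<close>. If there are \<open>K d\<close> such words, the
  decoder errs with probability \<open>1 - 2 / K d\<close>, and \<open>d\<close> is uniform over the nonzero codewords.

  Rates below 1/2: a pair of distinct nonzero words lies in the random code with probability at most
  \<open>1 / 4 ^ l\<close>, so a difference of weight \<open>w\<close> contributes at most \<open>min 1 (2 ^ (w - l)) \<le> x ^ (w - l)\<close>
  for every \<open>x\<close> in \<open>[1, 2]\<close>. Summing over all words bounds the error by
  \<open>2 ((1 + x) / 2) ^ n / x ^ l\<close>, which decays exponentially for \<open>x\<close> slightly above 1.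

  Rates above 1/2: by counting syndromes \<open>K d \<ge> 2 ^ (w - l)\<close>, and typically \<open>w\<close> is near
  \<open>n / 2\<close>, which exceeds \<open>l\<close> by a linear margin.
\<close>

text \<open>Keeps sums and products over \<open>bit\<close> in ring form, so that distributivity and
  the laws of finite sums apply.\<close>

declare add_bit_eq_xor [simp del] mult_bit_eq_and [simp del]

section \<open>Binary words and their supports\<close>

definition supp :: "bit vec \<Rightarrow> nat set" where
  "supp v = {i. i < dim_vec v \<and> v $ i = 1}"

lemma supp_subset: "v \<in> carrier_vec n \<Longrightarrow> supp v \<subseteq> {..<n}"
  by (auto simp: supp_def)

lemma finite_supp [simp]: "finite (supp v)"
  by (simp add: supp_def)

lemma bit_add_self [simp]: "a + a = (0 :: bit)"
  by (cases a) simp_all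

lemma bit_add_eq_0_iff [simp]: "a + b = 0 \<longleftrightarrow> a = (b :: bit)"
  by (cases a; cases b) simp_all

lemma bit_add_eq_1_iff [simp]: "a + b = 1 \<longleftrightarrow> a \<noteq> (b :: bit)"
  by (cases a; cases b) simp_all

lemma bit_vec_add_self [simp]: "v \<in> carrier_vec n \<Longrightarrow> v + v = (0\<^sub>v n :: bit vec)"
  by (intro eq_vecI) auto

lemma bit_vec_add_cancel [simp]:
  "v \<in> carrier_vec n \<Longrightarrow> w \<in> carrier_vec n \<Longrightarrow> v + (v + w) = (w :: bit vec)"
  by (subst assoc_add_vec [symmetric, of v n v w]) auto

lemma bit_vec_add_eq_0_iff:
  assumes "v \<in> carrier_vec n" "w \<in> carrier_vec n"
  shows "v + w = 0\<^sub>v n \<longleftrightarrow> v = (w :: bit vec)"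
  using assms by (auto simp: vec_eq_iff)

text \<open>Turns counting of words into counting of subsets; the inverse sends a set to its
  indicator vector.\<close>

lemma bij_betw_supp:
  assumes "S \<subseteq> {..<n}"
  shows "bij_betw supp {v \<in> carrier_vec n. supp v \<subseteq> S} (Pow S)"
proof (rule bij_betwI [where g = "\<lambda>T. vec n (\<lambda>i. of_bool (i \<in> T))"])
  show "(\<lambda>T. vec n (\<lambda>i. of_bool (i \<in> T))) \<in> Pow S \<rightarrow> {v \<in> carrier_vec n. supp v \<subseteq> S}"
    by (auto simp: supp_def)
  show "vec n (\<lambda>i. of_bool (i \<in> supp v)) = v" if "v \<in> {v \<in> carrier_vec n. supp v \<subseteq> S}" for v
    using that bit_not_one_iff by (intro eq_vecI) (auto simp: supp_def)
  show "supp (vec n (\<lambda>i. of_bool (i \<in> T))) = T" if "T \<in> Pow S" for T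
    using that assms by (auto simp: supp_def)
qed auto

lemma bij_betw_supp_carrier: "bij_betw supp (carrier_vec n) (Pow {..<n})"
proof -
  have "{v \<in> carrier_vec n. supp v \<subseteq> {..<n}} = carrier_vec n"
    using supp_subset by blast
  then show ?thesis
    using bij_betw_supp [of "{..<n}" n] by simp
qed

lemma finite_carrier_vec_bit [simp]: "finite (carrier_vec n :: bit vec set)"
  using bij_betw_finite [OF bij_betw_supp_carrier] by simp

lemma card_supp_subset:
  assumes "S \<subseteq> {..<n}"
  shows "card {v \<in> carrier_vec n. supp v \<subseteq> S} = 2 ^ card S"
  using bij_betw_same_card [OF bij_betw_supp [OF assms]] finite_subset [OF assms]
  by (simp add: card_Pow)

lemma card_carrier_vec_bit: "card (carrier_vec n :: bit vec set) = 2 ^ n"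
  using bij_betw_same_card [OF bij_betw_supp_carrier] by (simp add: card_Pow)

text \<open>The weight enumerator of the full space: expanding the product of \<open>n\<close>
  factors \<open>x + 1\<close> yields one term per support.\<close>

lemma sum_power_card_supp:
  "(\<Sum>v\<in>carrier_vec n. x ^ card (supp v)) = (1 + x :: real) ^ n"
proof -
  have "(\<Sum>v\<in>carrier_vec n. x ^ card (supp v)) = (\<Sum>T\<in>Pow {..<n}. x ^ card T)"
    by (rule sum.reindex_bij_betw [OF bij_betw_supp_carrier])
  also have "\<dots> = (\<Prod>i<n. x + 1)"
    by (subst prod_add) auto
  finally show ?thesis by (simp add: add.commute)
qed

text \<open>Complementation injects the light vectors into the heavy ones.\<close>

lemma card_light_vectors:
  assumes "2 * m < n"
  shows "2 * card {v \<in> carrier_vec n. card (supp v) \<le> m} \<le> 2 ^ n"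
proof -
  let ?L = "{T \<in> Pow {..<n}. card T \<le> m}"
  let ?c = "\<lambda>T. {..<n} - T"
  have "card {v \<in> carrier_vec n. card (supp v) \<le> m} = card ?L"
  proof (rule bij_betw_same_card [of supp])
    show "bij_betw supp {v \<in> carrier_vec n. card (supp v) \<le> m} ?L"
    proof (rule bij_betw_subset [OF bij_betw_supp_carrier])
      have "supp ` {v \<in> carrier_vec n. card (supp v) \<le> m} = {T \<in> supp ` carrier_vec n. card T \<le> m}"
        by auto
      then show "supp ` {v \<in> carrier_vec n. card (supp v) \<le> m} = ?L"
        by (simp add: bij_betw_imp_surj_on [OF bij_betw_supp_carrier])
    qed auto
  qed
  moreover have "inj_on ?c ?L"
    by (rule inj_onI) blast
  moreover have "?L \<inter> ?c ` ?L = {}"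
  proof -
    have "\<not> card (?c T) \<le> m" if "T \<subseteq> {..<n}" "card T \<le> m" for T
      using that assms finite_subset [OF that(1)] by (simp add: card_Diff_subset)
    then show ?thesis by auto
  qed
  then have "card ?L + card (?c ` ?L) = card (?L \<union> ?c ` ?L)"
    by (subst card_Un_disjoint) auto
  moreover have "card (?L \<union> ?c ` ?L) \<le> card (Pow {..<n})"
    by (rule card_mono) auto
  ultimately show ?thesis
    by (simp add: card_image card_Pow)
qed

section \<open>Uniformity of the random parity-check matrix\<close>

lemma bij_betw_mat:
  "bij_betw (mat l n) (PiE_dflt ({..<l} \<times> {..<n}) 0 (\<lambda>_. UNIV)) (carrier_mat l n)"
proof (rule bij_betwI [where g = "\<lambda>A (i, j). if i < l \<and> j < n then A $$ (i, j) else 0"])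
  show "mat l n (\<lambda>(i, j). if i < l \<and> j < n then A $$ (i, j) else 0) = A"
    if "A \<in> carrier_mat l n" for A
    using that by (intro eq_matI) auto
qed (auto simp: PiE_dflt_def fun_eq_iff)

lemma UNIV_bit: "(UNIV :: bit set) = {0, 1}"
  by (auto intro: bit.exhaust)

instance bit :: finite
  by standard (simp add: UNIV_bit)

lemma finite_carrier_mat_bit [simp]: "finite (carrier_mat l n :: bit mat set)"
proof -
  have "finite (PiE_dflt ({..<l} \<times> {..<n}) (0 :: bit) (\<lambda>_. UNIV))"
    by (rule finite_PiE_dflt) auto
  then show ?thesis
    using bij_betw_finite [OF bij_betw_mat] by blast
qed

lemma carrier_mat_nonempty [simp]: "carrier_mat l n \<noteq> {}"
  using zero_carrier_mat by blast

text \<open>A fair bit is uniform, products and bijective images of uniform laws are uniform. The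
  entries have default 0 outside the index rectangle, which makes \<open>mat l n\<close> injective
  on them. From here on probabilities are ratios of counts.\<close>

lemma random_parity_check_uniform: "random_parity_check l n = pmf_of_set (carrier_mat l n)"
proof -
  have "bij_betw (of_bool :: bool \<Rightarrow> bit) UNIV UNIV"
    by (auto simp: bij_betw_def inj_def UNIV_bool UNIV_bit)
  then have "map_pmf of_bool (bernoulli_pmf (1/2)) = pmf_of_set (UNIV :: bit set)"
    unfolding bernoulli_pmf_half_conv_pmf_of_set by (intro map_pmf_of_set_bij_betw) auto
  moreover have "PiE_dflt ({..<l} \<times> {..<n}) (0 :: bit) (\<lambda>_. UNIV) \<noteq> {}"
    by (auto simp: PiE_dflt_def)
  moreover have "finite (PiE_dflt ({..<l} \<times> {..<n}) (0 :: bit) (\<lambda>_. UNIV))"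
    by (rule finite_PiE_dflt) auto
  ultimately show ?thesis
    unfolding random_parity_check_def
    by (simp add: Pi_pmf_of_set map_pmf_of_set_bij_betw [OF bij_betw_mat])
qed

section \<open>Counting matrices that annihilate given words\<close>

text \<open>
  Translating by a matrix that sends \<open>v\<close> to \<open>u\<close> moves the matrices annihilating \<open>v\<close> to those
  sending \<open>v\<close> to \<open>u\<close>, so all these fibres are equally large. The same holds for pairs.
\<close>

lemma card_annihilators:
  fixes v :: "bit vec"
  assumes v: "v \<in> carrier_vec n" "v \<noteq> 0\<^sub>v n"
  shows "card {H \<in> carrier_mat l n. H *\<^sub>v v = 0\<^sub>v l} * 2 ^ l \<le> card (carrier_mat l n :: bit mat set)"
proof -
  from v obtain j where j: "j < n" "v $ j = 1"
    by (auto simp: vec_eq_iff)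
  \<comment> \<open>Only column \<open>j\<close> is nonzero, and \<open>v $ j = 1\<close>, so
    \<open>M u\<close> sends \<open>v\<close> to \<open>u\<close>.\<close>
  define M :: "bit vec \<Rightarrow> bit mat" where "M u = mat l n (\<lambda>(i, k). if k = j then u $ i else 0)" for u
  have M [simp]: "M u \<in> carrier_mat l n" "dim_row (M u) = l" "dim_col (M u) = n" for u
    by (simp_all add: M_def)
  have Mv: "M u *\<^sub>v v = u" if "u \<in> carrier_vec l" for u
    using that v(1) j
    by (intro eq_vecI)
       (auto simp: M_def scalar_prod_def if_distrib [of "\<lambda>x. x * _"] cong: if_cong)
  let ?A = "{H \<in> carrier_mat l n. H *\<^sub>v v = 0\<^sub>v l}"
  \<comment> \<open>Applying \<open>H + M u\<close> to \<open>v\<close> recovers \<open>u\<close>,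
    and then \<open>H\<close>.\<close>
  have "inj_on (\<lambda>(H, u). H + M u) (?A \<times> carrier_vec l)"
  proof (rule inj_onI, clarify)
    fix H u H' u'
    assume *: "H \<in> carrier_mat l n" "H *\<^sub>v v = 0\<^sub>v l" "u \<in> carrier_vec l"
      "H' \<in> carrier_mat l n" "H' *\<^sub>v v = 0\<^sub>v l" "u' \<in> carrier_vec l" "H + M u = H' + M u'"
    have "(H + M u) *\<^sub>v v = u" "(H' + M u') *\<^sub>v v = u'"
      using *(1-6) v(1) by (simp_all add: add_mult_distrib_mat_vec [of _ l n] Mv)
    with * have "u = u'" by simp
    with * have "H = H'"
      by (intro eq_matI) (auto simp: mat_eq_iff)
    with \<open>u = u'\<close> show "H = H' \<and> u = u'" by simp
  qed
  then have "card (?A \<times> (carrier_vec l :: bit vec set)) \<le> card (carrier_mat l n :: bit mat set)"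
    by (rule card_inj_on_le) auto
  then show ?thesis
    by (simp add: card_cartesian_product card_carrier_vec_bit)
qed

lemma card_pair_annihilators:
  fixes d e :: "bit vec"
  assumes d: "d \<in> carrier_vec n" and e: "e \<in> carrier_vec n" "e \<noteq> 0\<^sub>v n" "e \<noteq> d"
    and sub: "supp e \<subseteq> supp d"
  shows "card {H \<in> carrier_mat l n. H *\<^sub>v d = 0\<^sub>v l \<and> H *\<^sub>v e = 0\<^sub>v l} * 4 ^ l
         \<le> card (carrier_mat l n :: bit mat set)"
proof -
  from e obtain j where j: "j < n" "e $ j = 1"
    by (auto simp: vec_eq_iff)
  with d e sub have dj: "d $ j = 1"
    by (auto simp: supp_def)
  from d e(1,3) obtain k where "k < n" "e $ k \<noteq> d $ k"
    by (auto simp: vec_eq_iff)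
  with d e(1) sub have k: "k < n" "e $ k = 0" "d $ k = 1"
    using bit_not_one_iff by (auto simp: supp_def)
  from j k have jk: "j \<noteq> k" by auto
  \<comment> \<open>On the coordinates \<open>(j, k)\<close> the word \<open>e\<close> reads
    \<open>(1, 0)\<close> and \<open>d\<close> reads \<open>(1, 1)\<close>. With \<open>w\<close> in
    column \<open>j\<close> and \<open>u + w\<close> in column \<open>k\<close>, \<open>e\<close> is
    sent to \<open>w\<close>, and \<open>d\<close> to \<open>w + (u + w) = u\<close>.\<close>
  define M :: "bit vec \<Rightarrow> bit vec \<Rightarrow> bit mat" where
    "M u w = mat l n (\<lambda>(i, c). (if c = j then w $ i else 0) + (if c = k then u $ i + w $ i else 0))" for u w
  have M [simp]: "M u w \<in> carrier_mat l n" "dim_row (M u w) = l" "dim_col (M u w) = n" for u w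
    by (simp_all add: M_def)
  have Md: "M u w *\<^sub>v d = u" if "u \<in> carrier_vec l" "w \<in> carrier_vec l" for u w
    using that d j dj k jk
    by (intro eq_vecI)
       (auto simp: M_def scalar_prod_def if_distrib [of "\<lambda>x. x * _"] distrib_right sum.distrib
          add.left_commute [of _ "u $ _"] cong: if_cong)
  have Me: "M u w *\<^sub>v e = w" if "u \<in> carrier_vec l" "w \<in> carrier_vec l" for u w
    using that e(1) j k jk
    by (intro eq_vecI)
       (auto simp: M_def scalar_prod_def if_distrib [of "\<lambda>x. x * _"] distrib_right sum.distrib
          cong: if_cong)
  let ?A = "{H \<in> carrier_mat l n. H *\<^sub>v d = 0\<^sub>v l \<and> H *\<^sub>v e = 0\<^sub>v l}"
  have "inj_on (\<lambda>(H, u, w). H + M u w) (?A \<times> carrier_vec l \<times> carrier_vec l)"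
  proof (rule inj_onI, clarify)
    fix H u w H' u' w'
    assume *: "H \<in> carrier_mat l n" "H *\<^sub>v d = 0\<^sub>v l" "H *\<^sub>v e = 0\<^sub>v l"
      "u \<in> carrier_vec l" "w \<in> carrier_vec l"
      "H' \<in> carrier_mat l n" "H' *\<^sub>v d = 0\<^sub>v l" "H' *\<^sub>v e = 0\<^sub>v l"
      "u' \<in> carrier_vec l" "w' \<in> carrier_vec l" "H + M u w = H' + M u' w'"
    have "(H + M u w) *\<^sub>v d = u" "(H' + M u' w') *\<^sub>v d = u'"
      "(H + M u w) *\<^sub>v e = w" "(H' + M u' w') *\<^sub>v e = w'"
      using *(1-10) d e(1) by (simp_all add: add_mult_distrib_mat_vec [of _ l n] Md Me)
    with * have "u = u'" "w = w'" by simp_all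
    with * have "H = H'"
      by (intro eq_matI) (auto simp: mat_eq_iff)
    with \<open>u = u'\<close> \<open>w = w'\<close> show "H = H' \<and> (u, w) = (u', w')" by simp
  qed
  then have "card (?A \<times> (carrier_vec l :: bit vec set) \<times> (carrier_vec l :: bit vec set))
    \<le> card (carrier_mat l n :: bit mat set)"
    by (rule card_inj_on_le) auto
  then show ?thesis
    by (simp add: card_cartesian_product card_carrier_vec_bit power_mult_distrib [symmetric])
qed

section \<open>Codewords below a given support\<close>

definition subcode :: "bit vec set \<Rightarrow> bit vec \<Rightarrow> bit vec set" where
  "subcode C d = {e \<in> C. supp e \<subseteq> supp d}"

lemma supp_add: "v \<in> carrier_vec n \<Longrightarrow> w \<in> carrier_vec n \<Longrightarrow> supp (v + w) \<subseteq> supp v \<union> supp w"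
  using bit_not_one_iff by (auto simp: supp_def)

lemma mat_kernel_add:
  fixes H :: "bit mat"
  assumes "H \<in> carrier_mat l n" "v \<in> mat_kernel H" "w \<in> mat_kernel H"
  shows "v + w \<in> mat_kernel H"
  using assms by (auto simp: mat_kernel mult_add_distrib_mat_vec)

text \<open>Pigeonhole over the \<open>2 ^ l\<close> possible syndromes.\<close>

lemma card_subcode_kernel_ge:
  fixes H :: "bit mat"
  assumes H: "H \<in> carrier_mat l n" and d: "d \<in> carrier_vec n"
  shows "2 ^ card (supp d) \<le> card (subcode (mat_kernel H) d) * 2 ^ l"
proof -
  let ?S = "{e \<in> carrier_vec n. supp e \<subseteq> supp d}"
  let ?K = "subcode (mat_kernel H) d"
  have fin: "finite ?S" by simp
  have finK: "finite ?K"
    by (rule finite_subset [OF _ fin]) (use H in \<open>auto simp: subcode_def mat_kernel\<close>)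
  \<comment> \<open>Adding a fixed member \<open>e0\<close> of a nonempty fibre moves the fibre into
    the subcode: equal syndromes cancel in characteristic 2, and supports stay inside that of
    \<open>d\<close>.\<close>
  have "card {e \<in> ?S. H *\<^sub>v e = u} \<le> card ?K" for u
  proof (cases "{e \<in> ?S. H *\<^sub>v e = u} = {}")
    case False
    then obtain e0 where e0: "e0 \<in> carrier_vec n" "supp e0 \<subseteq> supp d" "H *\<^sub>v e0 = u" by blast
    have u: "u \<in> carrier_vec l" using e0 H by auto
    show ?thesis
    proof (rule card_inj_on_le [OF _ _ finK])
      show "inj_on (\<lambda>e. e0 + e) {e \<in> ?S. H *\<^sub>v e = u}"
        by (rule inj_on_inverseI [where g = "\<lambda>e. e0 + e"]) (use e0 in auto)
      show "(\<lambda>e. e0 + e) ` {e \<in> ?S. H *\<^sub>v e = u} \<subseteq> ?K"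
        using e0 u H supp_add [of e0 n]
        by (fastforce simp: subcode_def mat_kernel mult_add_distrib_mat_vec [OF H])
    qed
  qed (metis (lifting) card.empty le0)
  then have "(\<Sum>u\<in>carrier_vec l. card {e \<in> ?S. H *\<^sub>v e = u}) \<le> (\<Sum>u\<in>(carrier_vec l :: bit vec set). card ?K)"
    by (intro sum_mono)
  moreover have "card ?S = (\<Sum>u\<in>carrier_vec l. card {e \<in> ?S. H *\<^sub>v e = u})"
    by (subst card_eq_sum, subst sum.group [OF fin, of "carrier_vec l" "\<lambda>e. H *\<^sub>v e", symmetric])
       (use H in auto)
  ultimately show ?thesis
    using supp_subset [OF d] by (simp add: card_supp_subset card_carrier_vec_bit mult.commute)
qed

lemma card_mat_kernel_ge:
  fixes H :: "bit mat"
  assumes H: "H \<in> carrier_mat l n"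
  shows "2 ^ n \<le> card (mat_kernel H) * 2 ^ l"
proof -
  \<comment> \<open>The all-one word has full support, so the subcode below it is the entire
    kernel.\<close>
  let ?d = "vec n (\<lambda>_. 1) :: bit vec"
  have supp: "supp ?d = {..<n}"
    by (auto simp: supp_def)
  have "subcode (mat_kernel H) ?d = mat_kernel H"
    using supp_subset H by (fastforce simp: subcode_def supp mat_kernel)
  with card_subcode_kernel_ge [OF H, of ?d] show ?thesis
    by (simp add: supp)
qed

section \<open>Error probability of a fixed linear code\<close>

locale binary_linear_code =
  fixes n :: nat and C :: "bit vec set"
  assumes code_subset: "C \<subseteq> carrier_vec n"
    and code_zero: "0\<^sub>v n \<in> C"
    and code_add: "x \<in> C \<Longrightarrow> y \<in> C \<Longrightarrow> x + y \<in> C"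
begin

lemma code_carrier [simp]: "x \<in> C \<Longrightarrow> x \<in> carrier_vec n"
  using code_subset by blast

lemma code_dim [simp]: "x \<in> C \<Longrightarrow> dim_vec x = n"
  using code_carrier carrier_vecD by blast

lemma finite_code [simp]: "finite C"
  by (rule finite_subset [OF code_subset finite_carrier_vec_bit])

lemma finite_subcode [simp]: "finite (subcode C d)"
  by (simp add: subcode_def)

lemma card_code_pos: "card C > 0"
  using code_zero by (auto simp: card_gt_0_iff)

lemma card_code_eq_Suc: "card C = Suc (card (C - {0\<^sub>v n}))"
  by (rule card.remove [OF finite_code code_zero])

lemma zero_in_subcode: "0\<^sub>v n \<in> subcode C d"
  using code_zero by (auto simp: subcode_def supp_def)

lemma self_in_subcode: "d \<in> C \<Longrightarrow> d \<in> subcode C d"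
  by (simp add: subcode_def)

lemma card_subcode_ge_2:
  assumes "d \<in> C - {0\<^sub>v n}"
  shows "card (subcode C d) \<ge> 2"
proof -
  have "card {0\<^sub>v n, d} \<le> card (subcode C d)"
    using assms zero_in_subcode self_in_subcode by (intro card_mono) auto
  with assms show ?thesis by auto
qed

text \<open>The average is 0 exactly where the two fingerprints differ and equals their common sign
  elsewhere, so only shared coordinates constrain a candidate.\<close>

lemma consistent_users_pair:
  assumes x: "x1 \<in> C" "x2 \<in> C" "x1 \<noteq> x2"
  shows "consistent_users C (averaging_forgery n {x1, x2})
    = {x \<in> C. \<forall>i<n. x1 $ i = x2 $ i \<longrightarrow> x $ i = x1 $ i}"
proof -
  have fp: "fingerprint x $ i = (if x $ i = 0 then -1 else 1)" if "x \<in> C" "i < n" for x i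
    using that by (simp add: fingerprint_def)
  have y: "averaging_forgery n {x1, x2} $ i = (fingerprint x1 $ i + fingerprint x2 $ i) / 2"
    if "i < n" for i
    using that x by (simp add: averaging_forgery_def)
  have dim: "dim_vec (averaging_forgery n {x1, x2}) = n"
    by (simp add: averaging_forgery_def)
  have iff: "(averaging_forgery n {x1, x2} $ i \<noteq> 0
      \<longrightarrow> fingerprint z $ i = averaging_forgery n {x1, x2} $ i)
    \<longleftrightarrow> (x1 $ i = x2 $ i \<longrightarrow> z $ i = x1 $ i)" if "z \<in> C" "i < n" for z i
    using that x
    by (cases "x1 $ i"; cases "x2 $ i"; cases "z $ i") (simp_all add: y fp)
  show ?thesis
    unfolding consistent_users_def dim by (intro Collect_cong conj_cong refl all_cong1 imp_cong iff)
qed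

text \<open>Adding \<open>x1\<close> is an involution of the code. It turns agreement with
  \<open>x1\<close> wherever \<open>x1\<close> and \<open>x2\<close> agree into having support
  inside that of \<open>x1 + x2\<close>.\<close>

lemma card_consistent_users:
  assumes x: "x1 \<in> C" "x2 \<in> C" "x1 \<noteq> x2"
  shows "card (consistent_users C (averaging_forgery n {x1, x2})) = card (subcode C (x1 + x2))"
proof (rule bij_betw_same_card)
  have supp: "supp (x1 + z) \<subseteq> supp (x1 + x2) \<longleftrightarrow> (\<forall>i<n. x1 $ i = x2 $ i \<longrightarrow> z $ i = x1 $ i)"
    if "z \<in> C" for z
  proof -
    have "supp (x1 + w) = {i. i < n \<and> x1 $ i \<noteq> w $ i}" if "w \<in> C" for w
      using that x(1) by (auto simp: supp_def)
    then show ?thesis using that x by auto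
  qed
  show "bij_betw (\<lambda>z. x1 + z) (consistent_users C (averaging_forgery n {x1, x2})) (subcode C (x1 + x2))"
    unfolding consistent_users_pair [OF x]
  proof (rule bij_betwI [where g = "\<lambda>z. x1 + z"])
    show "(\<lambda>z. x1 + z) \<in> {x \<in> C. \<forall>i<n. x1 $ i = x2 $ i \<longrightarrow> x $ i = x1 $ i} \<rightarrow> subcode C (x1 + x2)"
      using supp code_add [OF x(1)] by (simp add: subcode_def Pi_iff)
    show "(\<lambda>z. x1 + z) \<in> subcode C (x1 + x2) \<rightarrow> {x \<in> C. \<forall>i<n. x1 $ i = x2 $ i \<longrightarrow> x $ i = x1 $ i}"
    proof
      fix z assume "z \<in> subcode C (x1 + x2)"
      then have z: "z \<in> C" "supp z \<subseteq> supp (x1 + x2)" by (auto simp: subcode_def)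
      then have "x1 + (x1 + z) = z" using x by (intro bit_vec_add_cancel [of _ n]) auto
      with z show "x1 + z \<in> {x \<in> C. \<forall>i<n. x1 $ i = x2 $ i \<longrightarrow> x $ i = x1 $ i}"
        using supp [of "x1 + z"] code_add [OF x(1) z(1)] by simp
    qed
    show "x1 + (x1 + z) = z" if "z \<in> {x \<in> C. \<forall>i<n. x1 $ i = x2 $ i \<longrightarrow> x $ i = x1 $ i}" for z
      using that x by (intro bit_vec_add_cancel [of _ n]) auto
    show "x1 + (x1 + z) = z" if "z \<in> subcode C (x1 + x2)" for z
      using that x by (intro bit_vec_add_cancel [of _ n]) (auto simp: subcode_def)
  qed
qed

text \<open>Both pirates are always among the candidates, so a uniform choice hits them with
  probability 2 over the number of candidates.\<close>

lemma pmf_md_decoder_miss: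
  assumes x: "x1 \<in> C" "x2 \<in> C" "x1 \<noteq> x2"
  shows "pmf (do {g \<leftarrow> md_decoder C (averaging_forgery n {x1, x2}); return_pmf (g \<notin> {x1, x2})}) True
    = 1 - 2 / card (subcode C (x1 + x2))"
proof -
  let ?S = "consistent_users C (averaging_forgery n {x1, x2})"
  have sub: "{x1, x2} \<subseteq> ?S"
    using x by (auto simp: consistent_users_pair)
  have fin: "finite ?S"
    by (simp add: consistent_users_def)
  have "(\<Sum>g\<in>?S. pmf (return_pmf (g \<notin> {x1, x2})) True) = (\<Sum>g\<in>?S. of_bool (g \<notin> {x1, x2}))"
    by (intro sum.cong) (auto simp: pmf_return)
  also have "\<dots> = real (card (?S - {x1, x2}))"
    using fin by (simp add: set_diff_eq Int_def)
  also have "\<dots> = real (card ?S) - 2"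
    using sub x fin card_mono [OF fin sub] by (subst card_Diff_subset) (auto simp: of_nat_diff)
  moreover have "card ?S > 0"
    using sub fin by (auto simp: card_gt_0_iff)
  ultimately show ?thesis
    using fin sub unfolding md_decoder_def
    by (subst pmf_bind_pmf_of_set) (auto simp: card_consistent_users [OF x] diff_divide_distrib)
qed

text \<open>Each coalition is counted once per member: a member \<open>x\<close> and the other
  member correspond to \<open>x\<close> and a nonzero difference \<open>d\<close>, with
  \<open>d\<close> ranging independently of \<open>x\<close>.\<close>

lemma sum_coalitions:
  "2 * (\<Sum>U\<in>coalitions C. F U) = (\<Sum>x\<in>C. \<Sum>d\<in>C - {0\<^sub>v n}. F {x, x + d} :: real)"
proof -
  have fin: "finite (coalitions C)"
    by (rule finite_subset [of _ "Pow C"]) (auto simp: coalitions_def)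
  have finU: "finite U" if "U \<in> coalitions C" for U
    using that by (auto simp: coalitions_def intro: card_ge_0_finite)
  have "2 * (\<Sum>U\<in>coalitions C. F U) = (\<Sum>U\<in>coalitions C. \<Sum>x\<in>U. F U)"
    by (simp add: sum_distrib_left coalitions_def)
  also have "\<dots> = (\<Sum>(U, x)\<in>Sigma (coalitions C) (\<lambda>U. U). F U)"
    using fin finU by (subst sum.Sigma) auto
  also have "\<dots> = (\<Sum>(x, d)\<in>C \<times> (C - {0\<^sub>v n}). F {x, x + d})"
  proof -
    have eq: "x + d = x \<longleftrightarrow> d = 0\<^sub>v n" if "x \<in> C" "d \<in> C" for x d
      using that code_carrier [OF that(1)] code_carrier [OF that(2)] by (auto simp: vec_eq_iff)
    have cancel: "x + (x + y) = y" if "x \<in> C" "y \<in> C" for x y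
      using that by (intro bit_vec_add_cancel [of _ n]) auto
    have "bij_betw (\<lambda>(x, d). ({x, x + d}, x)) (C \<times> (C - {0\<^sub>v n})) (Sigma (coalitions C) (\<lambda>U. U))"
      unfolding bij_betw_def
    proof (intro conjI equalityI subsetI)
      show "inj_on (\<lambda>(x, d). ({x, x + d}, x)) (C \<times> (C - {0\<^sub>v n}))"
      proof (rule inj_onI)
        fix p q assume pq: "p \<in> C \<times> (C - {0\<^sub>v n})" "q \<in> C \<times> (C - {0\<^sub>v n})"
          "(\<lambda>(x, d). ({x, x + d}, x)) p = (\<lambda>(x, d). ({x, x + d}, x)) q"
        obtain x d x' d' where [simp]: "p = (x, d)" "q = (x', d')"
          by (cases p; cases q) blast
        have "x' = x" "x + d = x + d'"
          using pq by (auto simp: doubleton_eq_iff)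
        then have "x + (x + d) = x + (x + d')" by simp
        then show "p = q" using pq \<open>x' = x\<close> by (simp add: cancel)
      qed
    next
      fix p assume "p \<in> (\<lambda>(x, d). ({x, x + d}, x)) ` (C \<times> (C - {0\<^sub>v n}))"
      then obtain x d where *: "p = ({x, x + d}, x)" "x \<in> C" "d \<in> C" "d \<noteq> 0\<^sub>v n" by auto
      then have "x \<noteq> x + d" using eq by metis
      with * show "p \<in> Sigma (coalitions C) (\<lambda>U. U)"
        by (auto simp: coalitions_def code_add)
    next
      fix p assume "p \<in> Sigma (coalitions C) (\<lambda>U. U)"
      then obtain U x where p: "p = (U, x)" "U \<subseteq> C" "card U = 2" "x \<in> U"
        by (auto simp: coalitions_def)
      then obtain y where y: "U = {x, y}" "x \<noteq> y"
        by (auto simp: card_2_iff)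
      with p have xy: "x \<in> C" "y \<in> C" by auto
      then have "x + y \<noteq> 0\<^sub>v n"
        using y by (subst bit_vec_add_eq_0_iff) auto
      with p y xy show "p \<in> (\<lambda>(x, d). ({x, x + d}, x)) ` (C \<times> (C - {0\<^sub>v n}))"
        by (intro image_eqI [of _ _ "(x, x + y)"]) (auto simp: cancel code_add)
    qed
    from sum.reindex_bij_betw [OF this, of "\<lambda>(U, x). F U"] show ?thesis
      by (simp add: case_prod_unfold)
  qed
  finally show ?thesis
    by (simp add: sum.cartesian_product)
qed

text \<open>The error probability depends on a coalition only through its difference, so averaging
  over coalitions becomes averaging over nonzero codewords.\<close>

lemma pmf_misidentification:
  "pmf (misidentification n C) True
    = (\<Sum>d\<in>C - {0\<^sub>v n}. 1 - 2 / card (subcode C d)) / (real (card C) - 1)"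
proof -
  let ?h = "\<lambda>d. 1 - 2 / real (card (subcode C d))"
  let ?F = "\<lambda>U. pmf (do {g \<leftarrow> md_decoder C (averaging_forgery n U); return_pmf (g \<notin> U)}) True"
  have fin: "finite (coalitions C)"
    by (rule finite_subset [of _ "Pow C"]) (auto simp: coalitions_def)
  \<comment> \<open>Summing the constant 1 counts the coalitions.\<close>
  have card: "2 * real (card (coalitions C)) = card C * (real (card C) - 1)"
    using sum_coalitions [of "\<lambda>_. 1"] card_code_eq_Suc by simp
  have F: "?F {x, x + d} = ?h d" if "x \<in> C" "d \<in> C - {0\<^sub>v n}" for x d
  proof -
    have "x + (x + d) = d"
      using that by (intro bit_vec_add_cancel [of _ n]) auto
    moreover from this have "x + d \<noteq> x"
      using that by auto
    ultimately show ?thesis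
      using that pmf_md_decoder_miss [of x "x + d"] by (simp add: code_add)
  qed
  have "2 * (\<Sum>U\<in>coalitions C. ?F U) = (\<Sum>x\<in>C. \<Sum>d\<in>C - {0\<^sub>v n}. ?h d)"
    unfolding sum_coalitions by (intro sum.cong F refl)
  then have sum: "2 * (\<Sum>U\<in>coalitions C. ?F U) = card C * (\<Sum>d\<in>C - {0\<^sub>v n}. ?h d)"
    by simp
  show ?thesis
  proof (cases "coalitions C = {}")
    case True
    \<comment> \<open>With a single codeword the event is false by convention, and the right-hand
      side is a division by zero, hence 0.\<close>
    with card card_code_pos have "card C = 1" by auto
    with True show ?thesis
      by (simp add: misidentification_def)
  next
    case False
    have "pmf (misidentification n C) True = (\<Sum>U\<in>coalitions C. ?F U) / card (coalitions C)"
      using False fin by (simp add: misidentification_def pmf_bind_pmf_of_set)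
    also have "\<dots> = (2 * (\<Sum>U\<in>coalitions C. ?F U)) / (2 * real (card (coalitions C)))"
      by simp
    also have "\<dots> = (\<Sum>d\<in>C - {0\<^sub>v n}. ?h d) / (real (card C) - 1)"
      unfolding card sum using card_code_pos by simp
    finally show ?thesis .
  qed
qed

end

section \<open>Averaging over the ensemble\<close>

lemma binary_linear_code_mat_kernel:
  assumes "H \<in> carrier_mat l n"
  shows "binary_linear_code n (mat_kernel H)"
proof
  show "mat_kernel H \<subseteq> carrier_vec n"
    by (rule mat_kernel_carrier [OF assms])
  show "0\<^sub>v n \<in> mat_kernel H"
    using assms by (auto simp: mat_kernel [OF assms] intro!: eq_vecI)
  show "x + y \<in> mat_kernel H" if "x \<in> mat_kernel H" "y \<in> mat_kernel H" for x y
    by (rule mat_kernel_add [OF assms that])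
qed

text \<open>The conditional error probability for the code with parity checks \<open>H\<close>,
  given that the coalition has difference \<open>d\<close>.\<close>

definition miss :: "bit mat \<Rightarrow> bit vec \<Rightarrow> real" where
  "miss H d = 1 - 2 / card (subcode (mat_kernel H) d)"

lemma misid_prob_eq:
  "misid_prob R n =
    (\<Sum>H\<in>carrier_mat (num_checks n R) n.
       (\<Sum>d\<in>mat_kernel H - {0\<^sub>v n}. miss H d)
       / (real (card (mat_kernel H)) - 1))
    / card (carrier_mat (num_checks n R) n :: bit mat set)"
proof -
  have "misid_prob R n = (\<Sum>H\<in>carrier_mat (num_checks n R) n. pmf (misidentification n (mat_kernel H)) True)
      / card (carrier_mat (num_checks n R) n :: bit mat set)"
    unfolding misid_prob_def random_parity_check_uniform
    by (rule pmf_bind_pmf_of_set) auto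
  also have "(\<Sum>H\<in>carrier_mat (num_checks n R) n. pmf (misidentification n (mat_kernel H)) True)
    = (\<Sum>H\<in>carrier_mat (num_checks n R) n.
       (\<Sum>d\<in>mat_kernel H - {0\<^sub>v n}. miss H d)
       / (real (card (mat_kernel H)) - 1))"
    unfolding miss_def
    by (intro sum.cong refl binary_linear_code.pmf_misidentification binary_linear_code_mat_kernel)
  finally show ?thesis .
qed

lemma miss_nonneg:
  assumes "H \<in> carrier_mat l n" "d \<in> mat_kernel H - {0\<^sub>v n}"
  shows "0 \<le> miss H d"
proof -
  interpret binary_linear_code n "mat_kernel H"
    by (rule binary_linear_code_mat_kernel [OF assms(1)])
  show ?thesis
    using card_subcode_ge_2 [OF assms(2)] by (simp add: miss_def)
qed

text \<open>Passes from the words of a given code to the matrices annihilating a given word, the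
  form to which the annihilator counts apply.\<close>

lemma sum_kernel_swap:
  fixes f :: "bit mat \<Rightarrow> bit vec \<Rightarrow> real"
  shows "(\<Sum>H\<in>carrier_mat l n. \<Sum>d\<in>mat_kernel H - {0\<^sub>v n}. f H d)
    = (\<Sum>d\<in>carrier_vec n - {0\<^sub>v n}. \<Sum>H | H \<in> carrier_mat l n \<and> H *\<^sub>v d = 0\<^sub>v l. f H d)"
proof -
  have "(\<Sum>H\<in>carrier_mat l n. \<Sum>d\<in>mat_kernel H - {0\<^sub>v n}. f H d)
    = (\<Sum>H\<in>carrier_mat l n. \<Sum>d | d \<in> carrier_vec n - {0\<^sub>v n} \<and> H *\<^sub>v d = 0\<^sub>v l. f H d)"
    by (intro sum.cong) (auto simp: mat_kernel)
  then show ?thesis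
    by (simp only:) (rule sum.swap_restrict, auto)
qed

section \<open>Upper bound on the error probability\<close>

text \<open>
  For words lighter than \<open>l\<close> the union bound over the wrong candidates is used, for the others
  the trivial bound 1; both are dominated by \<open>x ^ (card (supp d) - l)\<close>, read with a signed exponent.
\<close>

lemma sum_miss_le:
  fixes x :: real
  assumes d: "d \<in> carrier_vec n" "d \<noteq> 0\<^sub>v n" and x: "1 \<le> x" "x \<le> 2"
  shows "(\<Sum>H | H \<in> carrier_mat l n \<and> H *\<^sub>v d = 0\<^sub>v l. miss H d) * (2 * x) ^ l
    \<le> card (carrier_mat l n :: bit mat set) * x ^ card (supp d)" (is "?T * _ \<le> ?N * x ^ ?w")
proof (cases "l \<le> ?w")
  case True
  let ?A = "{H \<in> carrier_mat l n. H *\<^sub>v d = 0\<^sub>v l}"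
  have "?T \<le> (\<Sum>H\<in>?A. 1)"
    by (intro sum_mono) (simp add: miss_def)
  then have "?T * 2 ^ l \<le> real (card ?A) * 2 ^ l"
    by simp
  also have "\<dots> \<le> ?N"
    using of_nat_mono [OF card_annihilators [OF d, of l], where 'a = real] by simp
  finally have "?T * 2 ^ l \<le> ?N" .
  moreover have "x ^ l \<le> x ^ ?w"
    using True x by (intro power_increasing) auto
  ultimately have "(?T * 2 ^ l) * x ^ l \<le> ?N * x ^ ?w"
    using x by (intro mult_mono) auto
  then show ?thesis
    by (simp add: power_mult_distrib mult.assoc)
next
  case False
  let ?E = "{e \<in> carrier_vec n. supp e \<subseteq> supp d} - {0\<^sub>v n, d}"
  have "miss H d \<le> (\<Sum>e | e \<in> ?E \<and> H *\<^sub>v e = 0\<^sub>v l. 1)"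
    if H: "H \<in> carrier_mat l n" "H *\<^sub>v d = 0\<^sub>v l" for H
  proof -
    let ?K = "subcode (mat_kernel H) d"
    have dk: "d \<in> mat_kernel H - {0\<^sub>v n}"
      using H d by (auto simp: mat_kernel [OF H(1)])
    have E: "{e. e \<in> ?E \<and> H *\<^sub>v e = 0\<^sub>v l} = ?K - {0\<^sub>v n, d}"
      by (auto simp: subcode_def mat_kernel [OF H(1)])
    interpret binary_linear_code n "mat_kernel H"
      by (rule binary_linear_code_mat_kernel [OF H(1)])
    have K: "card ?K \<ge> 2"
      by (rule card_subcode_ge_2 [OF dk])
    have "card (?K - {0\<^sub>v n, d}) = card ?K - 2"
      using zero_in_subcode self_in_subcode [of d] dk d by (subst card_Diff_subset) auto
    with E have eq: "(\<Sum>e | e \<in> ?E \<and> H *\<^sub>v e = 0\<^sub>v l. 1) = real (card ?K) - 2"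
      using K by (simp add: of_nat_diff)
    \<comment> \<open>For \<open>K\<close> candidates the claim is
      \<open>1 - 2 / K \<le> K - 2\<close>: both sides vanish at \<open>K = 2\<close>, and for
      larger \<open>K\<close> the right side is at least 1.\<close>
    show ?thesis
    proof (cases "card ?K = 2")
      case True
      then show ?thesis unfolding eq by (simp add: miss_def)
    next
      case False
      with K have "real (card ?K) - 2 \<ge> 1" by simp
      moreover have "miss H d \<le> 1" by (simp add: miss_def)
      ultimately show ?thesis unfolding eq by linarith
    qed
  qed
  then have "?T \<le> (\<Sum>H | H \<in> carrier_mat l n \<and> H *\<^sub>v d = 0\<^sub>v l. \<Sum>e | e \<in> ?E \<and> H *\<^sub>v e = 0\<^sub>v l. 1)"
    by (intro sum_mono) auto
  also have "\<dots> = (\<Sum>e\<in>?E. \<Sum>H | H \<in> {H \<in> carrier_mat l n. H *\<^sub>v d = 0\<^sub>v l} \<and> H *\<^sub>v e = 0\<^sub>v l. 1)"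
    by (rule sum.swap_restrict) auto
  also have "\<dots> = (\<Sum>e\<in>?E. real (card {H \<in> carrier_mat l n. H *\<^sub>v d = 0\<^sub>v l \<and> H *\<^sub>v e = 0\<^sub>v l}))"
    by (simp add: conj_assoc)
  also have "\<dots> * 4 ^ l \<le> (\<Sum>e\<in>?E. ?N)"
    unfolding sum_distrib_right
    using of_nat_mono [OF card_pair_annihilators [OF d(1), of _ l], where 'a = real]
    by (intro sum_mono) auto
  also have "\<dots> = ?N * card ?E"
    by simp
  also have "\<dots> \<le> ?N * 2 ^ ?w"
  proof -
    have "card ?E \<le> card {e \<in> carrier_vec n. supp e \<subseteq> supp d}"
      by (intro card_mono) auto
    also have "\<dots> = 2 ^ ?w"
      by (rule card_supp_subset [OF supp_subset [OF d(1)]])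
    finally have "real (card ?E) \<le> 2 ^ ?w"
      using of_nat_mono [where 'a = real] by fastforce
    then show ?thesis by (intro mult_left_mono) auto
  qed
  finally have T: "?T * 4 ^ l \<le> ?N * 2 ^ ?w"
    by simp
  have "(4 :: real) ^ l = 2 ^ l * 2 ^ l"
    by (simp flip: power_mult_distrib)
  \<comment> \<open>The inequality is proved after multiplication by \<open>2 ^ l\<close>, which
    keeps all exponents natural numbers.\<close>
  then have "?T * (2 * x) ^ l * 2 ^ l = (?T * 4 ^ l) * x ^ l"
    by (simp add: power_mult_distrib)
  also have "\<dots> \<le> (?N * 2 ^ ?w) * x ^ l"
    using T x by (intro mult_right_mono) auto
  also have "\<dots> = (?N * 2 ^ ?w) * (x ^ ?w * x ^ (l - ?w))"
    using False by (simp flip: power_add)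
  \<comment> \<open>Here \<open>x \<le> 2\<close> enters; the powers of 2 then combine to
    \<open>2 ^ l\<close>, which is cancelled at the end.\<close>
  also have "\<dots> \<le> (?N * 2 ^ ?w) * (x ^ ?w * 2 ^ (l - ?w))"
    using x by (intro mult_left_mono power_mono) auto
  also have "\<dots> = ?N * x ^ ?w * (2 ^ ?w * 2 ^ (l - ?w))"
    by (simp only: ac_simps)
  also have "2 ^ ?w * 2 ^ (l - ?w) = (2 :: real) ^ l"
    using False by (simp flip: power_add)
  finally show ?thesis
    by (rule mult_right_le_imp_le) simp
qed

lemma card_carrier_mat_pos: "0 < card (carrier_mat l n :: bit mat set)"
  by (simp add: card_gt_0_iff)

text \<open>Bounding \<open>card (mat_kernel H) - 1\<close> below by half of
  \<open>2 ^ (n - l)\<close> makes the denominator independent of \<open>H\<close>. Exchanging the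
  sums then reduces the numerator to the weight enumerator at \<open>x\<close>.\<close>

lemma misid_prob_le:
  assumes l: "num_checks n R < n" and x: "1 \<le> x" "x \<le> 2"
  shows "misid_prob R n \<le> 2 * ((1 + x) / 2) ^ n / x ^ num_checks n R"
proof -
  define l where "l = num_checks n R"
  let ?N = "real (card (carrier_mat l n :: bit mat set))"
  let ?S = "\<lambda>H. \<Sum>d\<in>mat_kernel H - {0\<^sub>v n}. miss H d"
  have N: "?N > 0" using card_carrier_mat_pos by simp
  have "?S H / (real (card (mat_kernel H)) - 1) \<le> ?S H * (2 * 2 ^ l / 2 ^ n)"
    if H: "H \<in> carrier_mat l n" for H
  proof -
    have S: "?S H \<ge> 0"
      using miss_nonneg [OF H] by (intro sum_nonneg) auto
    have "(2 :: real) ^ n = 2 ^ l * 2 ^ (n - l)"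
      using l by (simp add: l_def flip: power_add)
    moreover have "(2 :: real) ^ 1 \<le> 2 ^ (n - l)"
      using l by (intro power_increasing) (auto simp: l_def)
    moreover have "2 ^ n \<le> real (card (mat_kernel H)) * 2 ^ l"
      using of_nat_mono [OF card_mat_kernel_ge [OF H], where 'a = real] by simp
    ultimately have c: "2 ^ n / 2 ^ l \<le> real (card (mat_kernel H))" "2 \<le> (2 :: real) ^ n / 2 ^ l"
      by (simp_all add: field_simps)
    \<comment> \<open>Since \<open>l < n\<close>, the quotient \<open>2 ^ n / 2 ^ l\<close> is at
      least 2, so subtracting 1 loses at most half of it.\<close>
    have "q / 2 \<le> m - 1" if "q \<le> m" "2 \<le> q" for q m :: real
      using that by linarith
    from this [OF c] have "2 ^ n / 2 ^ l / 2 \<le> real (card (mat_kernel H)) - 1" .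
    with c have "?S H / (real (card (mat_kernel H)) - 1) \<le> ?S H / (2 ^ n / 2 ^ l / 2)"
      using S by (intro divide_left_mono) auto
    then show ?thesis by (simp add: field_simps)
  qed
  then have "misid_prob R n \<le> (\<Sum>H\<in>carrier_mat l n. ?S H * (2 * 2 ^ l / 2 ^ n)) / ?N"
    unfolding misid_prob_eq l_def [symmetric] by (intro divide_right_mono sum_mono) auto
  also have "\<dots> = (\<Sum>H\<in>carrier_mat l n. ?S H) * (2 * 2 ^ l / 2 ^ n) / ?N"
    by (simp only: sum_distrib_right)
  also have "(\<Sum>H\<in>carrier_mat l n. ?S H)
    = (\<Sum>d\<in>carrier_vec n - {0\<^sub>v n}. \<Sum>H | H \<in> carrier_mat l n \<and> H *\<^sub>v d = 0\<^sub>v l. miss H d)"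
    by (rule sum_kernel_swap)
  also have "\<dots> * (2 * 2 ^ l / 2 ^ n) / ?N
      \<le> (?N / (2 * x) ^ l * (1 + x) ^ n) * (2 * 2 ^ l / 2 ^ n) / ?N"
  proof (intro divide_right_mono mult_right_mono)
    have "(\<Sum>d\<in>carrier_vec n - {0\<^sub>v n}. \<Sum>H | H \<in> carrier_mat l n \<and> H *\<^sub>v d = 0\<^sub>v l. miss H d)
      \<le> (\<Sum>d\<in>carrier_vec n - {0\<^sub>v n}. ?N / (2 * x) ^ l * x ^ card (supp d))"
      using x sum_miss_le [OF _ _ x, of _ n l]
      by (intro sum_mono) (auto simp: pos_le_divide_eq)
    also have "\<dots> \<le> (\<Sum>d\<in>carrier_vec n. ?N / (2 * x) ^ l * x ^ card (supp d))"
      using x by (intro sum_mono2) auto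
    also have "\<dots> = ?N / (2 * x) ^ l * (1 + x) ^ n"
      by (simp only: sum_distrib_left [symmetric] sum_power_card_supp)
    finally show "(\<Sum>d\<in>carrier_vec n - {0\<^sub>v n}. \<Sum>H | H \<in> carrier_mat l n \<and> H *\<^sub>v d = 0\<^sub>v l. miss H d)
      \<le> ?N / (2 * x) ^ l * (1 + x) ^ n" .
  qed auto
  also have "\<dots> = 2 * ((1 + x) / 2) ^ n / x ^ l"
    using N x by (simp add: power_mult_distrib power_divide mult.commute)
  finally show ?thesis by (simp add: l_def)
qed

section \<open>Lower bound on the error probability\<close>

text \<open>
  Below a word of weight at least \<open>l + 2\<close> there are at least four codewords, so the decoder errs
  with probability at least 1/2. At least a third of the nonzero codewords are that heavy on average.
\<close>

lemma misid_prob_ge: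
  assumes l: "2 * (num_checks n R + 1) < n"
  shows "misid_prob R n \<ge> 1 / 6"
proof -
  define l where "l = num_checks n R"
  let ?N = "real (card (carrier_mat l n :: bit mat set))"
  let ?S = "\<lambda>H. \<Sum>d\<in>mat_kernel H - {0\<^sub>v n}. miss H d"
  let ?light = "\<lambda>d. if card (supp d) \<le> l + 1 then 1 else 0 :: real"
  let ?L = "\<lambda>H. \<Sum>d\<in>mat_kernel H - {0\<^sub>v n}. ?light d"
  have N: "?N > 0" using card_carrier_mat_pos by simp
  \<comment> \<open>The factor \<open>2 / 3\<close> is \<open>1 / 2\<close> divided by
    \<open>3 / 4\<close>: a light word lowers the bound by \<open>1 / 2\<close>, and the number of
    nonzero codewords is at least \<open>3 / 4\<close> of \<open>2 ^ (n - l)\<close>.\<close>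
  have "?S H / (real (card (mat_kernel H)) - 1) \<ge> 1 / 2 - ?L H * (2 / 3 * 2 ^ l / 2 ^ n)"
    if H: "H \<in> carrier_mat l n" for H
  proof -
    interpret binary_linear_code n "mat_kernel H"
      by (rule binary_linear_code_mat_kernel [OF H])
    let ?M = "real (card (mat_kernel H)) - 1"
    have "1 / 2 - ?light d / 2 \<le> miss H d" if d: "d \<in> mat_kernel H - {0\<^sub>v n}" for d
    proof (cases "card (supp d) \<le> l + 1")
      case True
      then show ?thesis using miss_nonneg [OF H d] by simp
    next
      case False
      have dn: "d \<in> carrier_vec n" using d by simp
      have "(2 :: nat) ^ (l + 2) \<le> 2 ^ card (supp d)"
        using False by (intro power_increasing) auto
      also have "\<dots> \<le> card (subcode (mat_kernel H) d) * 2 ^ l"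
        by (rule card_subcode_kernel_ge [OF H dn])
      finally have "4 \<le> card (subcode (mat_kernel H) d)" by simp
      then have "2 / real (card (subcode (mat_kernel H) d)) \<le> 1 / 2"
        by (simp add: field_simps)
      with False show ?thesis by (simp add: miss_def)
    qed
    then have "(\<Sum>d\<in>mat_kernel H - {0\<^sub>v n}. 1 / 2 - ?light d / 2) \<le> ?S H"
      by (intro sum_mono)
    moreover have "(\<Sum>d\<in>mat_kernel H - {0\<^sub>v n}. 1 / 2 - ?light d / 2) = ?M / 2 - ?L H / 2"
      using card_code_eq_Suc by (simp add: sum_subtractf sum_divide_distrib)
    ultimately have S: "?M / 2 - ?L H / 2 \<le> ?S H" by simp
    have "(2 :: real) ^ n = 2 ^ l * 2 ^ (n - l)"
      using l by (simp add: l_def flip: power_add)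
    moreover have "(2 :: real) ^ 2 \<le> 2 ^ (n - l)"
      using l by (intro power_increasing) (auto simp: l_def)
    moreover have "2 ^ n \<le> real (card (mat_kernel H)) * 2 ^ l"
      using of_nat_mono [OF card_mat_kernel_ge [OF H], where 'a = real] by simp
    ultimately have c: "2 ^ n / 2 ^ l \<le> real (card (mat_kernel H))" "4 \<le> (2 :: real) ^ n / 2 ^ l"
      by (simp_all add: field_simps)
    \<comment> \<open>A quantity of size at least 4 loses at most a quarter when 1 is
      subtracted.\<close>
    then have M: "3 / 4 * (2 ^ n / 2 ^ l) \<le> ?M"
      by linarith
    have L: "?L H \<ge> 0" by (intro sum_nonneg) auto
    have Mpos: "?M > 0" using c by linarith
    have "1 / 2 - ?L H * (2 / 3 * 2 ^ l / 2 ^ n) = 1 / 2 - ?L H / (3 / 4 * (2 ^ n / 2 ^ l)) / 2"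
      by (simp add: field_simps)
    also have "\<dots> \<le> 1 / 2 - ?L H / ?M / 2"
      using M L Mpos by (intro diff_left_mono divide_right_mono divide_left_mono) auto
    also have "\<dots> = (?M / 2 - ?L H / 2) / ?M"
    proof -
      have "1 / 2 - a / m / 2 = (m / 2 - a / 2) / m" if "m > 0" for a m :: real
        using that by (simp add: field_simps)
      from this [OF Mpos] show ?thesis .
    qed
    also have "\<dots> \<le> ?S H / ?M"
      using S Mpos by (intro divide_right_mono) auto
    finally show ?thesis .
  qed
  then have "(\<Sum>H\<in>carrier_mat l n. 1 / 2 - ?L H * (2 / 3 * 2 ^ l / 2 ^ n)) / ?N \<le> misid_prob R n"
    unfolding misid_prob_eq l_def [symmetric] by (intro divide_right_mono sum_mono) auto
  moreover have "(\<Sum>H\<in>carrier_mat l n. 1 / 2 - ?L H * (2 / 3 * 2 ^ l / 2 ^ n))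
      = ?N / 2 - (\<Sum>H\<in>carrier_mat l n. ?L H) * (2 / 3 * 2 ^ l / 2 ^ n)"
    by (simp only: sum_subtractf sum_distrib_right sum_constant)
  \<comment> \<open>At most half of all words are light, and each nonzero word is in the kernel for
    at most a fraction \<open>1 / 2 ^ l\<close> of the matrices.\<close>
  moreover have "(\<Sum>H\<in>carrier_mat l n. ?L H) \<le> 2 ^ n / 2 * (?N / 2 ^ l)"
  proof -
    have "(\<Sum>H\<in>carrier_mat l n. ?L H)
      = (\<Sum>d\<in>carrier_vec n - {0\<^sub>v n}. \<Sum>H | H \<in> carrier_mat l n \<and> H *\<^sub>v d = 0\<^sub>v l. ?light d)"
      by (rule sum_kernel_swap)
    also have "\<dots> \<le> (\<Sum>d\<in>carrier_vec n - {0\<^sub>v n}. ?light d * (?N / 2 ^ l))"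
    proof (rule sum_mono)
      fix d :: "bit vec" assume "d \<in> carrier_vec n - {0\<^sub>v n}"
      then have "real (card {H \<in> carrier_mat l n. H *\<^sub>v d = 0\<^sub>v l}) \<le> ?N / 2 ^ l"
        using of_nat_mono [OF card_annihilators [of d n l], where 'a = real]
        by (simp add: field_simps)
      then show "(\<Sum>H | H \<in> carrier_mat l n \<and> H *\<^sub>v d = 0\<^sub>v l. ?light d) \<le> ?light d * (?N / 2 ^ l)"
        by simp
    qed
    also have "\<dots> \<le> (\<Sum>d\<in>carrier_vec n. ?light d * (?N / 2 ^ l))"
      by (intro sum_mono2) auto
    also have "\<dots> = card {d \<in> carrier_vec n. card (supp d) \<le> l + 1} * (?N / 2 ^ l)"
      by (subst sum_distrib_right [symmetric]) (simp add: sum.If_cases Int_def)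
    also have "\<dots> \<le> 2 ^ n / 2 * (?N / 2 ^ l)"
      using of_nat_mono [OF card_light_vectors [of "l + 1" n], where 'a = real] l
      by (intro mult_right_mono) (auto simp: l_def)
    finally show ?thesis .
  qed
  then have "(\<Sum>H\<in>carrier_mat l n. ?L H) * (2 / 3 * 2 ^ l / 2 ^ n)
      \<le> 2 ^ n / 2 * (?N / 2 ^ l) * (2 / 3 * 2 ^ l / 2 ^ n)"
    by (intro mult_right_mono) auto
  then have "(\<Sum>H\<in>carrier_mat l n. ?L H) * (2 / 3 * 2 ^ l / 2 ^ n) \<le> ?N / 3"
    by simp
  ultimately have "(?N / 2 - ?N / 3) / ?N \<le> misid_prob R n"
    using N by (smt (verit) divide_right_mono)
  moreover have "(?N / 2 - ?N / 3) / ?N = 1 / 6"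
    using N by (simp add: field_simps)
  ultimately show ?thesis by simp
qed

section \<open>Exponential decay below rate 1/2 and the threshold\<close>

text \<open>Both sides agree at \<open>x = 1\<close>, where their logarithmic derivatives are \<open>1/2\<close> and \<open>a\<close>.\<close>

lemma exists_base:
  fixes a :: real
  assumes "1 / 2 < a"
  obtains x where "1 < x" "x \<le> 2" "(1 + x) / 2 < x powr a"
proof -
  let ?g = "\<lambda>x :: real. a * ln x - ln ((1 + x) / 2)"
  have "(?g has_real_derivative a - 1 / 2) (at 1)"
    by (auto intro!: derivative_eq_intros)
  from DERIV_pos_inc_right [OF this] assms
  obtain e where e: "e > 0" "\<And>h. 0 < h \<Longrightarrow> h < e \<Longrightarrow> ?g 1 < ?g (1 + h)"
    by auto
  \<comment> \<open>Halving \<open>e\<close> keeps the increment strictly below \<open>e\<close>;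
    the cap 1 ensures \<open>x \<le> 2\<close>.\<close>
  define x where "x = 1 + min (e / 2) 1"
  have x: "1 < x" "x \<le> 2"
    using e by (auto simp: x_def)
  have "?g 1 < ?g x"
    unfolding x_def using e by (intro e(2)) auto
  then have "ln ((1 + x) / 2) < ln (x powr a)"
    using x by (simp add: ln_powr)
  then have "(1 + x) / 2 < x powr a"
    using x by (subst (asm) ln_less_cancel_iff) auto
  with x show ?thesis by (rule that)
qed

lemma exponentially_vanishing_misid_prob:
  assumes "0 < R" "R < 1 / 2"
  shows "exponentially_vanishing (misid_prob R)"
proof -
  obtain x where x: "1 < x" "x \<le> 2" "(1 + x) / 2 < x powr (1 - R)"
    using exists_base [of "1 - R"] assms by auto
  define p q where "p = ln ((1 + x) / 2)" and "q = ln (x powr (1 - R))"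
  \<comment> \<open>Half of the gap in the exponents is the decay rate; the other half absorbs the
    factor 2 of the upper bound.\<close>
  define c where "c = (q - p) / 2"
  have "p < q"
    unfolding p_def q_def using x by (subst ln_less_cancel_iff) auto
  then have c: "c > 0"
    by (simp add: c_def)
  \<comment> \<open>The first threshold gives \<open>n * R \<ge> 1\<close>, so that rounding up
    still leaves fewer than \<open>n\<close> checks; the second gives
    \<open>ln 2 \<le> c * n\<close>.\<close>
  have "misid_prob R n \<le> exp (- c * real n)" if n: "real n \<ge> 1 / R" "real n \<ge> ln 2 / c" for n
  proof -
    have l: "num_checks n R < n"
    proof -
      have "real n * R \<ge> 1" "n > 0"
        using n(1) assms by (auto simp: field_simps intro: Suc_leI gr0I)
      then have "real n * (1 - R) \<le> of_int (int n - 1)"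
        by (simp add: algebra_simps)
      then have "\<lceil>real n * (1 - R)\<rceil> \<le> int n - 1"
        by (simp only: ceiling_le_iff)
      with \<open>n > 0\<close> show ?thesis
        unfolding num_checks_def by linarith
    qed
    have "real n * (1 - R) \<le> real (num_checks n R)"
      unfolding num_checks_def by linarith
    then have "x powr (real n * (1 - R)) \<le> x powr real (num_checks n R)"
      using x by (intro powr_mono) auto
    also have "\<dots> = x ^ num_checks n R"
      using x by (simp add: powr_realpow)
    finally have "x powr (real n * (1 - R)) \<le> x ^ num_checks n R" .
    then have "2 * ((1 + x) / 2) ^ n / x ^ num_checks n R
        \<le> 2 * ((1 + x) / 2) ^ n / x powr (real n * (1 - R))"
      using x by (intro divide_left_mono) auto
    also have "\<dots> = exp (ln 2 - 2 * c * n)"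
    proof -
      have "((1 + x) / 2) ^ n = exp (real n * p)"
        using x by (simp add: p_def exp_of_nat_mult)
      moreover have "x powr (real n * (1 - R)) = exp (real n * q)"
        using x by (simp add: q_def powr_def)
      moreover have exponent: "ln 2 - 2 * c * n = ln 2 + real n * p - real n * q"
        by (simp add: c_def field_simps)
      ultimately show ?thesis
        unfolding exponent by (simp add: exp_add exp_diff)
    qed
    also have "\<dots> \<le> exp (- c * real n)"
      using n(2) c by (simp add: field_simps)
    finally show ?thesis
      using misid_prob_le [OF l, of x] x by simp
  qed
  moreover have "\<forall>\<^sub>F n in sequentially. real n \<ge> 1 / R \<and> real n \<ge> ln 2 / c"
    by (intro eventually_conj eventually_ge_at_top
         filterlim_at_top [THEN iffD1, OF filterlim_real_sequentially, rule_format])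
  ultimately have "\<forall>\<^sub>F n in sequentially. misid_prob R n \<le> exp (- c * real n)"
    by (auto elim: eventually_mono)
  with c show ?thesis
    unfolding exponentially_vanishing_def by blast
qed

lemma misid_prob_bounded_below:
  assumes "1 / 2 < R" "R < 1"
  shows "\<forall>\<^sub>F n in sequentially. misid_prob R n > 1 / 7"
proof -
  \<comment> \<open>Rounding up gives \<open>2 * (num_checks n R + 1) < 2 * n * (1 - R) + 4\<close>,
    which is at most \<open>n\<close> once \<open>n * (2 * R - 1) \<ge> 4\<close>. Any constant
    below \<open>1 / 6\<close> makes the bound strict.\<close>
  have "misid_prob R n > 1 / 7" if n: "real n \<ge> 4 / (2 * R - 1)" for n
  proof -
    have "real n * (2 * R - 1) \<ge> 4"
      using n assms by (simp add: field_simps)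
    moreover have "real (num_checks n R) < real n * (1 - R) + 1"
      using assms mult_nonneg_nonneg [of "real n" "1 - R"] unfolding num_checks_def by linarith
    ultimately have "real (2 * (num_checks n R + 1)) < real n"
      by (simp add: algebra_simps)
    then have "misid_prob R n \<ge> 1 / 6"
      by (intro misid_prob_ge) linarith
    then show ?thesis by simp
  qed
  moreover have "\<forall>\<^sub>F n in sequentially. real n \<ge> 4 / (2 * R - 1)"
    by (intro filterlim_at_top [THEN iffD1, OF filterlim_real_sequentially, rule_format])
  ultimately show ?thesis
    by (auto elim: eventually_mono)
qed

theorem theorem2:
  shows "is_capacity misid_prob (1/2)"
proof -
  have "\<exists>\<delta>>0. \<forall>\<^sub>F n in sequentially. misid_prob R n > \<delta>" if "1 / 2 < R" "R < 1" for R
    using misid_prob_bounded_below [OF that] by (intro exI [of _ "1 / 7"]) auto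
  then show ?thesis
    unfolding is_capacity_def using exponentially_vanishing_misid_prob by auto
qed

end
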